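(* For all integers $t \ge 11$, every edge-coloured graph $G$ on $n$ vertices with $\Delta^{\mathrm{mon}}(G) \le t$ can be edge-decomposed into $\lfloor t n/2 \rfloor$ rainbow matchings (some of which may be empty).
   Context: Graphs are simple and finite. An edge-coloured graph is a graph in which each edge is assigned a colour (not necessarily properly). A matching is rainbow if all its edges have distinct colours. $\Delta^{\mathrm{mon}}(G)$ denotes the largest maximum degree among the monochromatic subgraphs of $G$, i.e. the maximum over vertices $v$ and colours $c$ of the number of edges of colour $c$ incident with $v$. An edge-decomposition into matchings is a partition of $E(G)$ into (edge-disjoint) matchings. *)

theory Defs
  imports "HOL-Library.Ramsey" "HOL-Library.Disjoint_Sets"
begin

text \<open>
  A graph is given by its vertex set and its set of edges, an edge being a two-element set of
  vertices. A colouring is a total function on sets of vertices; only its values on the edge set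
  are ever used, and it need not be proper.
\<close>

definition simple_graph :: "'a set \<Rightarrow> 'a set set \<Rightarrow> bool" where
  "simple_graph V E \<longleftrightarrow> finite V \<and> E \<subseteq> [V]\<^bsup>2\<^esup>"

definition colour_degree :: "'a set set \<Rightarrow> ('a set \<Rightarrow> 'c) \<Rightarrow> 'c \<Rightarrow> 'a \<Rightarrow> nat" where
  "colour_degree E col c v = card {e \<in> E. col e = c \<and> v \<in> e}"

text \<open>
  The inserted \<open>0\<close> is relevant only for the graph without edges, where no colour occurs.
\<close>

definition mono_max_degree :: "'a set \<Rightarrow> 'a set set \<Rightarrow> ('a set \<Rightarrow> 'c) \<Rightarrow> nat" where
  "mono_max_degree V E col =
     Max (insert 0 {colour_degree E col c v | c v. c \<in> col ` E \<and> v \<in> V})"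

definition matching_in :: "'a set set \<Rightarrow> 'a set set \<Rightarrow> bool" where
  "matching_in E M \<longleftrightarrow> M \<subseteq> E \<and> disjoint M"

definition rainbow_matching :: "'a set set \<Rightarrow> ('a set \<Rightarrow> 'c) \<Rightarrow> 'a set set \<Rightarrow> bool" where
  "rainbow_matching E col M \<longleftrightarrow> matching_in E M \<and> inj_on col M"

text \<open>
  The matchings are indexed by \<open>{..<k}\<close>, so that several of them may be empty.
\<close>

definition rainbow_decomposable :: "'a set set \<Rightarrow> ('a set \<Rightarrow> 'c) \<Rightarrow> nat \<Rightarrow> bool" where
  "rainbow_decomposable E col k \<longleftrightarrow>
     (\<exists>M. (\<forall>i<k. rainbow_matching E col (M i)) \<and>
          disjoint_family_on M {..<k} \<and> (\<Union>i<k. M i) = E)"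

lemma simple_graph_finite_edges: "simple_graph V E \<Longrightarrow> finite E"
  unfolding simple_graph_def
  by (meson finite_imp_finite_nsets finite_subset)

lemma mono_max_degree_le_iff:
  assumes "simple_graph V E"
  shows "mono_max_degree V E col \<le> t \<longleftrightarrow> (\<forall>c. \<forall>v\<in>V. colour_degree E col c v \<le> t)"
proof -
  let ?f = "\<lambda>(c, v). colour_degree E col c v"
  have eq: "{colour_degree E col c v | c v. c \<in> col ` E \<and> v \<in> V} = ?f ` (col ` E \<times> V)"
    by force
  have fin: "finite (?f ` (col ` E \<times> V))"
    using assms simple_graph_finite_edges[OF assms] by (simp add: simple_graph_def)
  have zero: "colour_degree E col c v = 0" if "c \<notin> col ` E" for c v
  proof -
    have "{e \<in> E. col e = c \<and> v \<in> e} = {}" using that by blast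
    then show ?thesis by (simp only: colour_degree_def card.empty)
  qed
  have "mono_max_degree V E col \<le> t \<longleftrightarrow> (\<forall>c\<in>col ` E. \<forall>v\<in>V. colour_degree E col c v \<le> t)"
    unfolding mono_max_degree_def eq using fin by (subst Max_le_iff) auto
  also have "\<dots> \<longleftrightarrow> (\<forall>c. \<forall>v\<in>V. colour_degree E col c v \<le> t)"
    using zero by (metis le0)
  finally show ?thesis .
qed

end

theory Submission
  imports Defs
begin

text \<open>
  Label the edges one at a time with \<open>k = \<lfloor>tn/2\<rfloor>\<close> labels, taking colours in order of decreasing
  multiplicity. Let \<open>e = uv\<close> of colour \<open>c\<close> be the next edge and \<open>A\<close> the set of labels not occurring at
  \<open>u\<close> or \<open>v\<close>, so that \<open>|A| \<ge> k - 2n\<close>. If a label of \<open>A\<close> is not used on the colour \<open>c\<close>, give it to \<open>e\<close>.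
  Otherwise at least \<open>|A|\<close> edges of colour \<open>c\<close> have labels in \<open>A\<close>. As the colour \<open>c\<close> has at most \<open>k\<close>
  edges, some label \<open>i\<close> is not used on it, and if one of those edges misses all edges
  labelled \<open>i\<close>, then it can be relabelled \<open>i\<close> and pass its old label on to \<open>e\<close>. If none does, then
  \<open>|A| \<le> 2ts\<close>, where \<open>s\<close> is the number of colours met so far, because the edges labelled \<open>i\<close> have
  distinct colours. Each of these \<open>s\<close> colours has at least \<open>|A|\<close> edges, so \<open>s|A| \<le> n(n-1)/2\<close>. Hence
  \<open>|A|\<^sup>2 \<le> tn(n-1)\<close>, which is impossible when \<open>(t-4)\<^sup>2 \<ge> 4t\<close>, that is, when \<open>t \<ge> 11\<close>.
\<close>

text \<open>A partial decomposition is stored as one map from edges to labels: its fibres partition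
  \<open>F\<close> automatically, and moving an edge to another matching is a function
  update.\<close>

definition rainbow_labelling :: "('a set \<Rightarrow> 'c) \<Rightarrow> nat \<Rightarrow> 'a set set \<Rightarrow> ('a set \<Rightarrow> nat) \<Rightarrow> bool" where
  "rainbow_labelling col k F f \<longleftrightarrow>
     f ` F \<subseteq> {..<k} \<and>
     (\<forall>e\<in>F. \<forall>e'\<in>F. e \<noteq> e' \<longrightarrow> f e = f e' \<longrightarrow> e \<inter> e' = {} \<and> col e \<noteq> col e')"

lemma rainbow_labellingD:
  assumes "rainbow_labelling col k F f" "e \<in> F" "e' \<in> F" "e \<noteq> e'" "f e = f e'"
  shows "e \<inter> e' = {}" "col e \<noteq> col e'"
  using assms unfolding rainbow_labelling_def by blast+

text \<open>The edge \<open>e\<close> may already lie in \<open>F\<close>, since its own old label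
  is exempted by \<open>g \<noteq> e\<close>. This covers relabelling as well as extension.\<close>

lemma rainbow_labelling_update:
  assumes "rainbow_labelling col k F f" and "j < k"
    and "\<And>g. g \<in> F \<Longrightarrow> g \<noteq> e \<Longrightarrow> f g = j \<Longrightarrow> g \<inter> e = {} \<and> col g \<noteq> col e"
  shows "rainbow_labelling col k (insert e F) (f(e := j))"
  using assms unfolding rainbow_labelling_def image_subset_iff
  by (simp add: Int_commute) metis

lemma rainbow_decomposable_if_labelling:
  assumes "rainbow_labelling col k E f"
  shows "rainbow_decomposable E col k"
proof -
  let ?M = "\<lambda>i. {e \<in> E. f e = i}"
  have "rainbow_matching E col (?M i)" for i
    using rainbow_labellingD[OF assms]
    unfolding rainbow_matching_def matching_in_def disjoint_def inj_on_def by blast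
  moreover have "disjoint_family_on ?M {..<k}"
    unfolding disjoint_family_on_def by blast
  moreover have "(\<Union>i<k. ?M i) = E"
    using assms unfolding rainbow_labelling_def by blast
  ultimately show ?thesis
    unfolding rainbow_decomposable_def by (intro exI[of _ ?M]) auto
qed

lemma simple_graph_edge:
  assumes "simple_graph V E" "e \<in> E"
  shows "e \<subseteq> V" "card e = 2"
  using assms by (auto simp: simple_graph_def nsets_def)

lemma simple_graph_card_edges_le:
  assumes "simple_graph V E"
  shows "2 * card E \<le> card V * (card V - 1)"
proof -
  have "card E \<le> card ([V]\<^bsup>2\<^esup>)"
    using assms by (intro card_mono finite_imp_finite_nsets) (auto simp: simple_graph_def)
  then show ?thesis
    by (simp add: choose_two)
qed

lemma simple_graph_degree_le:
  assumes "simple_graph V E"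
  shows "card {e \<in> E. v \<in> e} \<le> card V"
proof (rule surj_card_le)
  show "finite V"
    using assms by (simp add: simple_graph_def)
  show "{e \<in> E. v \<in> e} \<subseteq> (\<lambda>w. {v, w}) ` V"
  proof
    fix e assume e: "e \<in> {e \<in> E. v \<in> e}"
    then have "e \<subseteq> V" "card e = 2"
      using simple_graph_edge[OF assms] by auto
    then show "e \<in> (\<lambda>w. {v, w}) ` V"
      using e by (auto simp: card_2_iff)
  qed
qed

lemma card_colour_class_le:
  assumes "simple_graph V E" and deg: "\<And>v. v \<in> V \<Longrightarrow> colour_degree E col c v \<le> t"
  shows "card {e \<in> E. col e = c} \<le> t * card V div 2"
proof -
  let ?D = "{e \<in> E. col e = c}"
  have fin: "finite V" "finite ?D"
    using assms(1) simple_graph_finite_edges[OF assms(1)] by (auto simp: simple_graph_def)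
  have "2 * card ?D = (\<Sum>e\<in>?D. card {v \<in> V. v \<in> e})"
  proof -
    have "card {v \<in> V. v \<in> e} = 2" if "e \<in> ?D" for e
      using simple_graph_edge[OF assms(1), of e] that
      by (simp add: Collect_conj_eq Int_absorb1)
    then show ?thesis
      by simp
  qed
  also have "\<dots> = (\<Sum>v\<in>V. card {e \<in> ?D. v \<in> e})"
    using sum.swap_restrict[OF fin(2,1), of "\<lambda>_ _. 1::nat" "\<lambda>e v. v \<in> e"] by simp
  also have "\<dots> \<le> (\<Sum>v\<in>V. t)"
    using deg by (intro sum_mono) (simp add: colour_degree_def conj_assoc)
  finally show ?thesis
    by (simp add: mult.commute)
qed

text \<open>Here \<open>a\<close> stands for the number of labels absent from both ends of the new
  edge, \<open>m\<close> for the size of its colour class in \<open>E\<close>, and \<open>s\<close>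
  for the number of colours already met.\<close>

lemma label_count_contradiction:
  fixes a k m n s t :: nat
  assumes "11 \<le> t" "2 \<le> n" "k = t * n div 2" "k \<le> a + 2 * n"
    and "a \<le> 2 * t * s" "a \<le> m" "2 * (s * m) \<le> n * (n - 1)"
  shows False
proof -
  have "a * a \<le> (2 * t * s) * m"
    using assms by (intro mult_mono) auto
  also have "\<dots> = t * (2 * (s * m))"
    by simp
  also have "\<dots> \<le> t * (n * (n - 1))"
    using assms by (intro mult_left_mono) auto
  finally have "int (a * a) \<le> int (t * (n * (n - 1)))"
    by linarith
  then have upper: "int a * int a \<le> int t * (int n * (int n - 1))"
    using \<open>2 \<le> n\<close> by (simp add: of_nat_diff)
  \<comment> \<open>The final 1 pays for the floor in \<open>k\<close>.\<close>
  have "t * n \<le> 2 * (a + 2 * n) + 1"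
    using assms(3,4) by presburger
  then have "int (t * n) \<le> int (2 * (a + 2 * n) + 1)"
    by linarith
  then have lower: "(int t - 4) * int n - 1 \<le> 2 * int a"
    by (simp add: algebra_simps)
  \<comment> \<open>After this shift the squared comparison has only positive coefficients:
    \<open>(t-4)^2 - 4*t\<close> is 5 at t = 11, but -4 at t = 10.\<close>
  define x where "x = int t - 11"
  define N where "N = int n"
  have x: "0 \<le> x" and N: "2 \<le> N" and t: "int t = x + 11"
    using assms(1,2) by (auto simp: x_def N_def)
  have "0 \<le> x * N"
    using x N by simp
  then have pos: "0 \<le> (x + 7) * N - 1"
    using N by (simp add: algebra_simps)
  have lower': "(x + 7) * N - 1 \<le> 2 * int a"
    using lower by (simp add: t N_def add.commute)
  have "((x + 7) * N - 1) * ((x + 7) * N - 1) \<le> (2 * int a) * (2 * int a)"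
    using lower' pos by (intro mult_mono) linarith+
  also have "\<dots> \<le> 4 * ((x + 11) * (N * (N - 1)))"
    using upper unfolding t N_def by simp
  finally have "x * x * (N * N) + 10 * (x * (N * N)) + 5 * (N * N) + 2 * (x * N) + 30 * N + 1 \<le> 0"
    by (simp add: algebra_simps)
  moreover have "0 \<le> x * x * (N * N)" "0 \<le> x * (N * N)" "0 \<le> N * N"
    using x N by simp_all
  ultimately show False
    using \<open>0 \<le> x * N\<close> N by linarith
qed

lemma rainbow_labelling_extend:
  fixes col :: "'a set \<Rightarrow> 'c"
  assumes t: "11 \<le> t" and G: "simple_graph V E"
    and deg: "\<And>c v. v \<in> V \<Longrightarrow> colour_degree E col c v \<le> t"
    and k: "k = t * card V div 2"
    and F: "F \<subseteq> E" and f: "rainbow_labelling col k F f" and e: "e \<in> E - F"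
    and large: "\<And>g. g \<in> F \<Longrightarrow> card {h \<in> E. col h = col e} \<le> card {h \<in> E. col h = col g}"
  shows "\<exists>f'. rainbow_labelling col k (insert e F) f'"
proof (rule ccontr)
  assume no: "\<nexists>f'. rainbow_labelling col k (insert e F) f'"
  define D where "D = {g \<in> F. col g = col e}"
  define m where "m = card {h \<in> E. col h = col e}"
  have fin: "finite E" "finite F" "finite V" "finite D"
    using simple_graph_finite_edges[OF G] G F
    by (auto simp: simple_graph_def D_def intro: finite_subset)
  have less_k: "f g < k" if "g \<in> F" for g
    using f that by (auto simp: rainbow_labelling_def)
  have "e \<subseteq> V" "card e = 2"
    using simple_graph_edge[OF G] e by auto
  then obtain u v where uv: "e = {u, v}"
    by (auto simp: card_2_iff)
  have n: "2 \<le> card V"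
    using card_mono[OF fin(3) \<open>e \<subseteq> V\<close>] \<open>card e = 2\<close> by simp
  define B where "B = f ` {g \<in> F. u \<in> g} \<union> f ` {g \<in> F. v \<in> g}"
  define A where "A = {..<k} - B"
  have card_B: "card B \<le> 2 * card V"
  proof -
    have "card (f ` {g \<in> F. w \<in> g}) \<le> card V" for w
    proof -
      have "card (f ` {g \<in> F. w \<in> g}) \<le> card {g \<in> F. w \<in> g}"
        using fin by (intro card_image_le) auto
      also have "\<dots> \<le> card {g \<in> E. w \<in> g}"
        using fin F by (intro card_mono) auto
      also have "\<dots> \<le> card V"
        by (rule simple_graph_degree_le[OF G])
      finally show ?thesis .
    qed
    from this[of u] this[of v] show ?thesis
      unfolding B_def by (intro order.trans[OF card_Un_le]) linarith
  qed
  have card_A: "k \<le> card A + 2 * card V"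
    using diff_card_le_card_Diff[of B "{..<k}"] card_B fin by (simp add: A_def B_def)
  have A_disj: "g \<inter> e = {}" if "g \<in> F" "f g \<in> A" for g
    using that unfolding A_def B_def uv by auto
  define T where "T = {g \<in> D. f g \<in> A}"
  have A_sub: "A \<subseteq> f ` T"
  proof
    fix j assume j: "j \<in> A"
    show "j \<in> f ` T"
    proof (rule ccontr)
      assume "j \<notin> f ` T"
      then have "rainbow_labelling col k (insert e F) (f(e := j))"
        using j A_disj by (intro rainbow_labelling_update[OF f]) (auto simp: T_def D_def A_def)
      then show False
        using no by blast
    qed
  qed
  have "finite T"
    using fin by (simp add: T_def)
  then have A_le_T: "card A \<le> card T"
    using A_sub by (rule surj_card_le)
  have "D \<subset> {h \<in> E. col h = col e}"
    using F e by (auto simp: D_def)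
  then have D_less: "card D < m"
    using fin by (auto simp: m_def intro: psubset_card_mono)
  have "m \<le> k"
    unfolding m_def k using deg by (rule card_colour_class_le[OF G])
  have "card (f ` D) < card {..<k}"
    using card_image_le[OF fin(4), of f] D_less \<open>m \<le> k\<close> by simp
  then have "\<not> {..<k} \<subseteq> f ` D"
    using fin card_mono[of "f ` D" "{..<k}"] by auto
  then obtain i where i: "i < k" "i \<notin> f ` D"
    by blast
  define M where "M = {g \<in> F. f g = i}"
  have meets: "g \<inter> \<Union>M \<noteq> {}" if g: "g \<in> T" for g
  proof
    assume disj: "g \<inter> \<Union>M = {}"
    have gF: "g \<in> F" "col g = col e" "f g \<in> A" "f g \<noteq> i"
      using g i by (auto simp: T_def D_def)
    have f': "rainbow_labelling col k F (f(g := i))"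
      using rainbow_labelling_update[OF f i(1), of g] disj i(2) gF
      by (auto simp: M_def D_def insert_absorb)
    \<comment> \<open>Any other edge with the old label of \<open>g\<close> differs in colour from
      \<open>g\<close>, hence from \<open>e\<close>; as that label lies in \<open>A\<close>, the
      edge also misses \<open>e\<close>.\<close>
    have "rainbow_labelling col k (insert e F) ((f(g := i))(e := f g))"
    proof (rule rainbow_labelling_update[OF f' less_k[OF gF(1)]])
      fix h assume h: "h \<in> F" "h \<noteq> e" "(f(g := i)) h = f g"
      then have "h \<noteq> g" "f h = f g"
        using gF by (auto split: if_splits)
      then show "h \<inter> e = {} \<and> col h \<noteq> col e"
        using rainbow_labellingD(2)[OF f h(1) gF(1)] A_disj[OF h(1)] gF by auto
    qed
    then show False
      using no by blast
  qed
  define s where "s = card (col ` F)"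
  have "inj_on col M"
    using rainbow_labellingD(2)[OF f] unfolding inj_on_def M_def by blast
  then have "card M = card (col ` M)"
    by (simp add: card_image)
  also have "\<dots> \<le> s"
    unfolding s_def using fin by (intro card_mono) (auto simp: M_def)
  finally have card_M: "card M \<le> s" .
  have M_edges: "g \<subseteq> V" "card g = 2" if "g \<in> M" for g
    using simple_graph_edge[OF G] F that by (auto simp: M_def)
  have UM: "\<Union>M \<subseteq> V" "finite (\<Union>M)"
    using M_edges finite_subset[OF _ fin(3), of "\<Union>M"] by auto
  have "card (\<Union>M) \<le> sum card M"
    by (rule card_Union_le_sum_card)
  also have "\<dots> = card M * 2"
    using M_edges by simp
  also have "\<dots> \<le> s * 2"
    using card_M by simp
  finally have card_UM: "card (\<Union>M) \<le> s * 2" .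
  \<comment> \<open>The edges in \<open>M\<close> cover at most \<open>2 * s\<close> vertices, and
    each vertex lies on at most \<open>t\<close> edges of the colour of \<open>e\<close>.\<close>
  have "T \<subseteq> (\<Union>w\<in>\<Union>M. {h \<in> E. col h = col e \<and> w \<in> h})"
    using meets F by (force simp: T_def D_def)
  then have "card T \<le> card (\<Union>w\<in>\<Union>M. {h \<in> E. col h = col e \<and> w \<in> h})"
    using fin(1) UM(2) by (intro card_mono finite_UN_I) simp_all
  also have "\<dots> \<le> (\<Sum>w\<in>\<Union>M. card {h \<in> E. col h = col e \<and> w \<in> h})"
    using UM(2) by (rule card_UN_le)
  also have "\<dots> \<le> (\<Sum>w\<in>\<Union>M. t)"
    using deg UM(1) by (intro sum_mono) (auto simp: colour_degree_def)
  also have "\<dots> \<le> s * 2 * t"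
    using card_UM by simp
  finally have T_le: "card T \<le> 2 * t * s"
    by (simp add: mult_ac)
  have T_le_m: "card T \<le> m"
    using card_mono[OF fin(4), of T] D_less by (auto simp: T_def)
  \<comment> \<open>Colour classes are disjoint, and by \<open>large\<close> each colour met so far
    has at least \<open>m\<close> edges in \<open>E\<close>.\<close>
  have "s * m = (\<Sum>c\<in>col ` F. m)"
    by (simp add: s_def)
  also have "\<dots> \<le> (\<Sum>c\<in>col ` F. card {h \<in> E. col h = c})"
    using large by (intro sum_mono) (auto simp: m_def)
  also have "\<dots> = card (\<Union>c\<in>col ` F. {h \<in> E. col h = c})"
    using fin by (intro card_UN_disjoint[symmetric]) auto
  also have "\<dots> \<le> card E"
    using fin by (intro card_mono) auto
  finally have "2 * (s * m) \<le> card V * (card V - 1)"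
    using simple_graph_card_edges_le[OF G] by linarith
  with t n k card_A order.trans[OF A_le_T T_le] order.trans[OF A_le_T T_le_m] show False
    by (rule label_count_contradiction)
qed

theorem theorem1p3:
  fixes t n :: nat
    and V :: "'a set" and E :: "'a set set"
    and col :: "'a set \<Rightarrow> 'c"
  assumes "t \<ge> 11"
    and "simple_graph V E"
    and "card V = n"
    and "mono_max_degree V E col \<le> t"
  shows "rainbow_decomposable E col (t * n div 2)"
proof -
  define k where "k = t * card V div 2"
  define size where "size = (\<lambda>e. card {h \<in> E. col h = col e})"
  have deg: "colour_degree E col c v \<le> t" if "v \<in> V" for c v
    using assms(2,4) that by (simp add: mono_max_degree_le_iff)
  have finE: "finite E"
    using assms(2) by (rule simple_graph_finite_edges)
  \<comment> \<open>The last conjunct keeps the order by decreasing multiplicity without fixing an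
    enumeration; colours of equal multiplicity may alternate. As \<open>size\<close> counts in all
    of \<open>E\<close>, it stays the same along the induction.\<close>
  have "\<exists>F f. F \<subseteq> E \<and> card F = r \<and> rainbow_labelling col k F f \<and>
    (\<forall>g\<in>F. \<forall>h\<in>E - F. size h \<le> size g)" if "r \<le> card E" for r
    using that
  proof (induction r)
    case 0
    show ?case
      by (intro exI[of _ "{}"]) (simp add: rainbow_labelling_def)
  next
    case (Suc r)
    then obtain F f where F: "F \<subseteq> E" "card F = r" "rainbow_labelling col k F f"
      and large: "\<forall>g\<in>F. \<forall>h\<in>E - F. size h \<le> size g"
      by auto
    have "E - F \<noteq> {}"
      using F Suc.prems by auto
    then have "Max (size ` (E - F)) \<in> size ` (E - F)"
      using finE by (intro Max_in) auto
    then obtain e where e: "e \<in> E - F" and "size e = Max (size ` (E - F))"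
      by auto
    then have max: "\<forall>h\<in>E - F. size h \<le> size e"
      using finE by simp
    obtain f' where "rainbow_labelling col k (insert e F) f'"
      using rainbow_labelling_extend[OF assms(1,2) deg k_def F(1,3) e] large e
      by (auto simp: size_def)
    moreover have "card (insert e F) = Suc r"
      using e F finite_subset[OF F(1) finE] by simp
    ultimately show ?case
      using F(1) e max large by (intro exI[of _ "insert e F"] exI[of _ f']) auto
  qed
  from this[of "card E"] obtain F f where "F \<subseteq> E" "card F = card E" "rainbow_labelling col k F f"
    by auto
  then have "rainbow_labelling col k E f"
    using card_subset_eq[OF finE] by blast
  then show ?thesis
    using rainbow_decomposable_if_labelling assms(3) by (auto simp: k_def)
qed

end
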